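(* Let $\mathbb{G}$ be an uncountable group, let $\mathbb{H}$ be a subgroup of $\mathbb{G}$, and let $\mathcal{A}$ be an alphabet. Let $\mathcal{L}_\infty$ be a collection of extended patterns over $\mathbb{G}$ and alphabet $\mathcal{A}$ satisfying the following four properties: ($L_1$) every subpattern of an element $P\in\mathcal{L}_\infty$ also belongs to $\mathcal{L}_\infty$; ($L_2$) for every $Q\in\mathcal{L}_\infty$ and every $g\in\mathbb{G}$ there exists $P\in\mathcal{L}_\infty$ such that $Q$ is a subpattern of $P$ and $\mathrm{dom}\,P=\mathrm{dom}\,Q\cup\{g\}$; ($L_3$) for every $P\in\mathcal{L}_\infty$ and every $g\in\mathbb{H}$, the $g$-shifted pattern $gP$ belongs to $\mathcal{L}_\infty$; ($L_4$) the union of any proper increasing well-ordered chain in $\mathcal{L}_\infty$ also belongs to $\mathcal{L}_\infty$. Let $\mathcal{L}$ be the set of all patterns in $\mathcal{L}_\infty$ (that is, the elements of $\mathcal{L}_\infty$ with finite domain). Then there exists an $\mathbb{H}$-subshift $X\subset\mathcal{A}^{\mathbb{G}}$ with $\mathcal{L}(X)=\mathcal{L}$.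
   Context: An alphabet $\mathcal{A}$ is a discrete topological space with at least two elements (possibly infinite). The group $\mathbb{G}$ is regarded as well-ordered in order type $|\mathbb{G}|$ (such a well-order exists by the axiom of choice). $\mathcal{A}^{\mathbb{G}}$ is the set of all functions $x:\mathbb{G}\to\mathcal{A}$, endowed with the prodiscrete topology (the product topology of the discrete topologies on $\mathcal{A}$). For $g\in\mathbb{G}$ the $g$-shift map $\sigma^g:\mathcal{A}^{\mathbb{G}}\to\mathcal{A}^{\mathbb{G}}$ is $\sigma^g(x)(\ell)=x(g\ell)$ for all $\ell\in\mathbb{G}$. For a subgroup $\mathbb{H}$ of $\mathbb{G}$, an $\mathbb{H}$-subshift is a nonempty closed set $X\subset\mathcal{A}^{\mathbb{G}}$ with $\sigma^g(X)=X$ for all $g\in\mathbb{H}$. A pattern (over $\mathbb{G}$ and $\mathcal{A}$) is a function $P:\mathbb{L}\to\mathcal{A}$ whose domain $\mathrm{dom}\,P=\mathbb{L}$ is a finite subset of $\mathbb{G}$. An extended pattern (over $\mathbb{G}$ and $\mathcal{A}$) is a function $P:\mathbb{L}\to\mathcal{A}$ with $\mathbb{L}\subset\mathbb{G}$ and $\mathbb{G}\setminus\mathbb{L}$ not finite; every pattern is an extended pattern. A pattern $P$ is allowed for an $\mathbb{H}$-subshift $X$ if there is $x\in X$ with $x|_{\mathrm{dom}\,P}=P$. The language $\mathcal{L}(X)$ is the set of all patterns (with finite domain) that are allowed for $X$. For extended patterns $P,Q$: $Q$ is a subpattern of $P$ if $\mathrm{dom}\,Q\subset\mathrm{dom}\,P$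 and $P|_{\mathrm{dom}\,Q}=Q$. For $g\in\mathbb{H}$, the $g$-shifted pattern $gP$ of $P:\mathbb{L}\to\mathcal{A}$ has domain $g\mathbb{L}=\{g\ell:\ell\in\mathbb{L}\}$ and is given by $gP(g\ell)=P(\ell)$ for all $\ell\in\mathbb{L}$. An increasing well-ordered chain in $\mathcal{L}_\infty$ is a map $\mathcal{R}:\Lambda\to\mathcal{L}_\infty$, where $(\Lambda,<)$ is a nonempty well-ordered set, such that for all $\alpha<\beta$ in $\Lambda$, $\mathcal{R}(\alpha)$ is a subpattern of $\mathcal{R}(\beta)$. It is proper if $\mathbb{G}\setminus\bigcup_{\lambda\in\Lambda}\mathrm{dom}\,\mathcal{R}(\lambda)$ is infinite. Its union is the function with domain $\bigcup_{\lambda\in\Lambda}\mathrm{dom}\,\mathcal{R}(\lambda)$ which takes the value $\mathcal{R}(\beta)(g)$ at $g$ whenever $g\in\mathrm{dom}\,\mathcal{R}(\beta)$.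
   Formalization: The collection L_∞ is additionally assumed nonempty: the empty collection satisfies (L1)–(L4) vacuously and has empty L, but the language of any subshift contains the empty pattern. *)

theory Defs
  imports "HOL-Algebra.Group" "HOL-Analysis.Function_Topology"
begin

section \<open>Configurations and subshifts\<close>

definition alphabet :: "'a set \<Rightarrow> bool" where
  "alphabet A \<longleftrightarrow> (\<exists>a\<in>A. \<exists>b\<in>A. a \<noteq> b)"

text \<open>Configurations are extensional functions: the carrier of the topology below
  is \<open>carrier G \<rightarrow>\<^sub>E A\<close>.\<close>

definition prodiscrete :: "('g, 'm) monoid_scheme \<Rightarrow> 'a set \<Rightarrow> ('g \<Rightarrow> 'a) topology" where
  "prodiscrete G A = product_topology (\<lambda>_. discrete_topology A) (carrier G)"

definition shift :: "('g, 'm) monoid_scheme \<Rightarrow> 'g \<Rightarrow> ('g \<Rightarrow> 'a) \<Rightarrow> 'g \<Rightarrow> 'a" where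
  "shift G g x = (\<lambda>l\<in>carrier G. x (g \<otimes>\<^bsub>G\<^esub> l))"

definition subshift ::
  "('g, 'm) monoid_scheme \<Rightarrow> 'g set \<Rightarrow> 'a set \<Rightarrow> ('g \<Rightarrow> 'a) set \<Rightarrow> bool" where
  "subshift G H A X \<longleftrightarrow>
     X \<noteq> {} \<and> closedin (prodiscrete G A) X \<and> (\<forall>g\<in>H. shift G g ` X = X)"


section \<open>Patterns\<close>

text \<open>A function \<open>L \<rightarrow> A\<close> with \<open>L \<subseteq> carrier G\<close> is a map \<open>P :: 'g \<rightharpoonup> 'a\<close> with \<open>dom P = L\<close> and
  \<open>ran P \<subseteq> A\<close>; then \<open>Q\<close> is a subpattern of \<open>P\<close> iff \<open>Q \<subseteq>\<^sub>m P\<close>.\<close>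

definition pattern :: "('g, 'm) monoid_scheme \<Rightarrow> 'a set \<Rightarrow> ('g \<rightharpoonup> 'a) \<Rightarrow> bool" where
  "pattern G A P \<longleftrightarrow> dom P \<subseteq> carrier G \<and> ran P \<subseteq> A \<and> finite (dom P)"

definition extended_pattern :: "('g, 'm) monoid_scheme \<Rightarrow> 'a set \<Rightarrow> ('g \<rightharpoonup> 'a) \<Rightarrow> bool" where
  "extended_pattern G A P \<longleftrightarrow>
     dom P \<subseteq> carrier G \<and> ran P \<subseteq> A \<and> infinite (carrier G - dom P)"

abbreviation subpattern :: "('g \<rightharpoonup> 'a) \<Rightarrow> ('g \<rightharpoonup> 'a) \<Rightarrow> bool" where
  "subpattern Q P \<equiv> Q \<subseteq>\<^sub>m P"

lemma subpattern_iff: "subpattern Q P \<longleftrightarrow> dom Q \<subseteq> dom P \<and> P |` dom Q = Q"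
proof
  assume "subpattern Q P"
  then have "dom Q \<subseteq> dom P" by (rule map_le_implies_dom_le)
  moreover have "P |` dom Q = Q"
  proof
    fix x
    show "(P |` dom Q) x = Q x"
      using \<open>subpattern Q P\<close> by (cases "x \<in> dom Q") (auto simp: map_le_def restrict_map_def dom_def)
  qed
  ultimately show "dom Q \<subseteq> dom P \<and> P |` dom Q = Q" by blast
next
  assume "dom Q \<subseteq> dom P \<and> P |` dom Q = Q"
  then show "subpattern Q P" by (metis map_le_def restrict_in)
qed

definition shifted_pattern ::
  "('g, 'm) monoid_scheme \<Rightarrow> 'g \<Rightarrow> ('g \<rightharpoonup> 'a) \<Rightarrow> ('g \<rightharpoonup> 'a)" where
  "shifted_pattern G g P =
     (\<lambda>m. if m \<in> (\<lambda>l. g \<otimes>\<^bsub>G\<^esub> l) ` dom P then P (inv\<^bsub>G\<^esub> g \<otimes>\<^bsub>G\<^esub> m) else None)"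

lemma shifted_pattern_apply:
  assumes "group G" "g \<in> carrier G" "dom P \<subseteq> carrier G" "l \<in> dom P"
  shows "shifted_pattern G g P (g \<otimes>\<^bsub>G\<^esub> l) = P l"
proof -
  interpret group G by fact
  have "l \<in> carrier G" using assms by blast
  then show ?thesis
    using assms by (simp add: shifted_pattern_def m_assoc [symmetric])
qed

lemma dom_shifted_pattern:
  assumes "group G" "g \<in> carrier G" "dom P \<subseteq> carrier G"
  shows "dom (shifted_pattern G g P) = (\<lambda>l. g \<otimes>\<^bsub>G\<^esub> l) ` dom P"
proof
  show "dom (shifted_pattern G g P) \<subseteq> (\<lambda>l. g \<otimes>\<^bsub>G\<^esub> l) ` dom P"
    by (auto simp: shifted_pattern_def split: if_splits)
  show "(\<lambda>l. g \<otimes>\<^bsub>G\<^esub> l) ` dom P \<subseteq> dom (shifted_pattern G g P)"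
    using shifted_pattern_apply [OF assms] by (auto simp: dom_def)
qed

definition allowed :: "('g \<Rightarrow> 'a) set \<Rightarrow> ('g \<rightharpoonup> 'a) \<Rightarrow> bool" where
  "allowed X P \<longleftrightarrow> (\<exists>x\<in>X. \<forall>l\<in>dom P. P l = Some (x l))"

definition language ::
  "('g, 'm) monoid_scheme \<Rightarrow> 'a set \<Rightarrow> ('g \<Rightarrow> 'a) set \<Rightarrow> ('g \<rightharpoonup> 'a) set" where
  "language G A X = {P. pattern G A P \<and> allowed X P}"


section \<open>Well-ordered chains of extended patterns\<close>

text \<open>Here \<open>r\<close> is the reflexive well-order \<open>\<le>\<close> of the index set \<open>\<Lambda>\<close>.\<close>

definition increasing_chain ::
  "('g \<rightharpoonup> 'a) set \<Rightarrow> 'i set \<Rightarrow> 'i rel \<Rightarrow> ('i \<Rightarrow> ('g \<rightharpoonup> 'a)) \<Rightarrow> bool" where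
  "increasing_chain L \<Lambda> r R \<longleftrightarrow>
     \<Lambda> \<noteq> {} \<and> well_order_on \<Lambda> r \<and> R ` \<Lambda> \<subseteq> L \<and>
     (\<forall>\<alpha>\<in>\<Lambda>. \<forall>\<beta>\<in>\<Lambda>. (\<alpha>, \<beta>) \<in> r \<and> \<alpha> \<noteq> \<beta> \<longrightarrow> subpattern (R \<alpha>) (R \<beta>))"

definition proper_chain ::
  "('g, 'm) monoid_scheme \<Rightarrow> 'i set \<Rightarrow> ('i \<Rightarrow> ('g \<rightharpoonup> 'a)) \<Rightarrow> bool" where
  "proper_chain G \<Lambda> R \<longleftrightarrow> infinite (carrier G - (\<Union>\<alpha>\<in>\<Lambda>. dom (R \<alpha>)))"

definition chain_union :: "'i set \<Rightarrow> ('i \<Rightarrow> ('g \<rightharpoonup> 'a)) \<Rightarrow> ('g \<rightharpoonup> 'a)" where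
  "chain_union \<Lambda> R =
     (\<lambda>g. if g \<in> (\<Union>\<alpha>\<in>\<Lambda>. dom (R \<alpha>))
          then Some (THE a. \<exists>\<beta>\<in>\<Lambda>. R \<beta> g = Some a) else None)"

lemma dom_chain_union: "dom (chain_union \<Lambda> R) = (\<Union>\<alpha>\<in>\<Lambda>. dom (R \<alpha>))"
  unfolding chain_union_def dom_if by auto

lemma chain_union_apply:
  assumes "increasing_chain L \<Lambda> r R" "\<beta> \<in> \<Lambda>" "g \<in> dom (R \<beta>)"
  shows "chain_union \<Lambda> R g = R \<beta> g"
proof -
  obtain a where a: "R \<beta> g = Some a" using assms(3) by blast
  have "b = a" if "\<gamma> \<in> \<Lambda>" "R \<gamma> g = Some b" for \<gamma> b
  proof (cases "\<gamma> = \<beta>")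
    case False
    have "total_on \<Lambda> r"
      using assms(1) by (simp add: increasing_chain_def order_on_defs)
    then have "(\<gamma>, \<beta>) \<in> r \<or> (\<beta>, \<gamma>) \<in> r"
      using False \<open>\<gamma> \<in> \<Lambda>\<close> \<open>\<beta> \<in> \<Lambda>\<close> by (simp add: total_on_def)
    then have "subpattern (R \<gamma>) (R \<beta>) \<or> subpattern (R \<beta>) (R \<gamma>)"
      using assms(1,2) False that(1) unfolding increasing_chain_def by blast
    then have "R \<gamma> g = R \<beta> g"
      using a that(2) by (auto simp: map_le_def dom_def)
    then show ?thesis using a that(2) by simp
  qed (use a that in simp)
  then have "(THE b. \<exists>\<gamma>\<in>\<Lambda>. R \<gamma> g = Some b) = a"
    using a assms(2) by blast
  then show ?thesis
    using assms(2,3) a by (auto simp: chain_union_def)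
qed

text \<open>Closure of \<open>L\<close> under unions of proper chains. HOL cannot quantify over the type of
  the index set, so chains are indexed by sets of partial maps; \<open>chain_closed_any_index\<close>
  shows that closure under chains indexed by well-ordered sets of any other type follows.\<close>

definition chain_closed :: "('g, 'm) monoid_scheme \<Rightarrow> ('g \<rightharpoonup> 'a) set \<Rightarrow> bool" where
  "chain_closed G L \<longleftrightarrow>
     (\<forall>(\<Lambda> :: ('g \<rightharpoonup> 'a) set) r R.
        increasing_chain L \<Lambda> r R \<and> proper_chain G \<Lambda> R \<longrightarrow> chain_union \<Lambda> R \<in> L)"

lemma chain_closed_any_index:
  fixes \<Lambda> :: "'i set" and R :: "'i \<Rightarrow> ('g \<rightharpoonup> 'a)"
  assumes L: "chain_closed G L"
    and chain: "increasing_chain L \<Lambda> r R" and proper: "proper_chain G \<Lambda> R"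
  shows "chain_union \<Lambda> R \<in> L"
proof -
  define S where "S = R ` \<Lambda>"
  define s where "s = {(P, Q). P \<in> S \<and> Q \<in> S \<and> subpattern P Q}"
  have wo: "well_order_on \<Lambda> r" using chain by (simp add: increasing_chain_def)
  have mono: "subpattern (R \<alpha>) (R \<beta>)" if "\<alpha> \<in> \<Lambda>" "\<beta> \<in> \<Lambda>" "(\<alpha>, \<beta>) \<in> r" for \<alpha> \<beta>
  proof (cases "\<alpha> = \<beta>")
    case False
    then show ?thesis using chain that unfolding increasing_chain_def by blast
  qed simp
  have tot: "(\<alpha>, \<beta>) \<in> r \<or> (\<beta>, \<alpha>) \<in> r" if "\<alpha> \<in> \<Lambda>" "\<beta> \<in> \<Lambda>" for \<alpha> \<beta>
  proof -
    have "refl_on \<Lambda> r" "total_on \<Lambda> r" using wo by (simp_all add: order_on_defs)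
    then show ?thesis using that by (cases "\<alpha> = \<beta>") (simp_all add: refl_on_def total_on_def)
  qed
  have "wf (s - Id)"
  proof (rule wfI_min)
    fix P and Q :: "('g \<rightharpoonup> 'a) set"
    assume "P \<in> Q"
    show "\<exists>z\<in>Q. \<forall>y. (y, z) \<in> s - Id \<longrightarrow> y \<notin> Q"
    proof (cases "P \<in> S")
      case True
      then obtain \<alpha>0 where \<alpha>0: "\<alpha>0 \<in> {\<alpha>\<in>\<Lambda>. R \<alpha> \<in> Q}" using \<open>P \<in> Q\<close> S_def by blast
      have "wf (r - Id)" using wo by (simp add: well_order_on_def)
      then obtain \<alpha> where \<alpha>: "\<alpha> \<in> {\<alpha>\<in>\<Lambda>. R \<alpha> \<in> Q}"
        and least: "\<And>\<beta>. (\<beta>, \<alpha>) \<in> r - Id \<Longrightarrow> \<beta> \<notin> {\<alpha>\<in>\<Lambda>. R \<alpha> \<in> Q}"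
        using \<alpha>0 by (rule wfE_min) blast
      have "y \<notin> Q" if y: "(y, R \<alpha>) \<in> s - Id" for y
      proof
        assume "y \<in> Q"
        obtain \<beta> where \<beta>: "\<beta> \<in> \<Lambda>" "y = R \<beta>" using y by (auto simp: s_def S_def)
        then have "(\<beta>, \<alpha>) \<notin> r - Id" using least \<open>y \<in> Q\<close> by blast
        then have "(\<alpha>, \<beta>) \<in> r" using tot \<alpha> \<beta> y by blast
        then have "subpattern (R \<alpha>) y" using mono \<alpha> \<beta> by blast
        moreover have "subpattern y (R \<alpha>)" using y by (auto simp: s_def)
        ultimately show False using y map_le_antisym by blast
      qed
      then show ?thesis using \<alpha> by blast
    next
      case False
      then show ?thesis using \<open>P \<in> Q\<close> by (auto simp: s_def)
    qed
  qed
  moreover have "total_on S s"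
  proof (rule total_onI)
    fix P Q assume "P \<in> S" "Q \<in> S" "P \<noteq> Q"
    then obtain \<alpha> \<beta> where "\<alpha> \<in> \<Lambda>" "P = R \<alpha>" "\<beta> \<in> \<Lambda>" "Q = R \<beta>"
      unfolding S_def by blast
    then have "subpattern P Q \<or> subpattern Q P" using tot mono by blast
    then show "(P, Q) \<in> s \<or> (Q, P) \<in> s"
      using \<open>P \<in> S\<close> \<open>Q \<in> S\<close> by (simp add: s_def)
  qed
  moreover have "antisym s" unfolding antisym_def s_def using map_le_antisym by blast
  moreover have "trans s" unfolding trans_def s_def using map_le_trans by blast
  moreover have "refl_on S s" "s \<subseteq> S \<times> S" by (auto simp: refl_on_def s_def)
  ultimately have "well_order_on S s" by (simp add: order_on_defs)
  then have "increasing_chain L S s id"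
    using chain by (auto simp: increasing_chain_def S_def s_def)
  moreover have "proper_chain G S id" using proper by (simp add: proper_chain_def S_def)
  ultimately have "chain_union S id \<in> L" using L unfolding chain_closed_def by blast
  moreover have "chain_union S id = chain_union \<Lambda> R"
    unfolding chain_union_def S_def by (simp cong: if_cong)
  ultimately show ?thesis by simp
qed

end

theory Submission
  imports Defs
begin

text \<open>Let \<open>X\<close> be the set of configurations all of whose finite restrictions lie in \<open>Linf\<close>. It is
  closed because membership is tested on finite windows, and \<open>H\<close>-invariant by \<open>L3\<close>. Given a finite
  \<open>P \<in> Linf\<close>, well-order the group so that all proper initial segments have infinite complement.
  Transfinite recursion then extends \<open>P\<close> one element at a time, by \<open>L2\<close>, taking unions by \<open>L4\<close>: these
  are proper since only an initial segment has been filled. The final union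
  need not be in \<open>Linf\<close>, but each of its finite restrictions already occurs at some stage.\<close>

text \<open>The cardinal order \<open>card_of S\<close> works: its proper initial segments are
  strictly smaller than \<open>S\<close>. A finite complement would make the infinite set
  \<open>S\<close> a union of two sets of strictly smaller cardinality, which is impossible.\<close>

lemma ex_well_order_infinite_complement:
  assumes "infinite S"
  shows "\<exists>r. well_order_on S r \<and> (\<forall>a\<in>S. infinite (S - underS r a))"
proof (intro exI conjI ballI)
  show "well_order_on S (card_of S)" by (rule card_of_well_order_on)
next
  fix a assume "a \<in> S"
  then have small: "(card_of (underS (card_of S) a), card_of S) \<in> ordLess"
    by (intro card_of_underS card_of_Card_order) (simp add: Field_card_of)
  have sub: "underS (card_of S) a \<subseteq> S"
    using card_of_well_order_on [of S] by (auto simp: underS_def order_on_defs)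
  show "infinite (S - underS (card_of S) a)"
  proof
    assume "finite (S - underS (card_of S) a)"
    then have "(card_of (S - underS (card_of S) a), card_of S) \<in> ordLess"
      using assms ordLess_ordLeq_trans finite_iff_ordLess_natLeq infinite_iff_natLeq_ordLeq
      by blast
    from card_of_Un_ordLess_infinite [OF assms small this] sub
    have "(card_of S, card_of S) \<in> ordLess" by (simp add: Un_absorb1)
    then show False using ordLess_irreflexive by blast
  qed
qed

text \<open>This serves twice: with \<open>P\<close> empty it gives a point of the subshift, and for
  general \<open>P\<close> it shows that every finite member of \<open>Linf\<close> is
  allowed.\<close>

lemma extend_to_configuration:
  fixes G :: "('g, 'm) monoid_scheme" and Linf :: "('g \<rightharpoonup> 'a) set"
  assumes inf: "infinite (carrier G)"
    and ext: "\<forall>Q\<in>Linf. extended_pattern G A Q"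
    and L1: "\<forall>P\<in>Linf. \<forall>Q. subpattern Q P \<longrightarrow> Q \<in> Linf"
    and L2: "\<forall>Q\<in>Linf. \<forall>g\<in>carrier G. \<exists>P\<in>Linf. subpattern Q P \<and> dom P = dom Q \<union> {g}"
    and L4: "chain_closed G Linf"
    and P: "P \<in> Linf" "finite (dom P)"
  shows "\<exists>x \<in> carrier G \<rightarrow>\<^sub>E A. (\<forall>l\<in>dom P. P l = Some (x l)) \<and>
    (\<forall>F. finite F \<and> F \<subseteq> carrier G \<longrightarrow> (Some \<circ> x) |` F \<in> Linf)"
proof -
  obtain r where wo: "well_order_on (carrier G) r"
    and tail: "\<And>a. a \<in> carrier G \<Longrightarrow> infinite (carrier G - underS r a)"
    using ex_well_order_infinite_complement [OF inf] by blast
  have wf: "wf (r - Id)" and refl: "refl_on (carrier G) r" and tot: "total_on (carrier G) r"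
    and tr: "trans r" and anti: "antisym r" and rC: "r \<subseteq> carrier G \<times> carrier G"
    using wo by (auto simp: order_on_defs)
  have domP: "dom P \<subseteq> carrier G" using P(1) ext by (auto simp: extended_pattern_def)
  \<comment> \<open>\<open>Q\<close> is an admissible stage \<open>a\<close> after the earlier
    stages \<open>f\<close>. Fixing its domain exactly, as \<open>dom P\<close> and the closed
    segment below \<open>a\<close>, is what later makes the chain proper. Off the carrier every
    \<open>Q\<close> is admissible, since the recursion runs over the whole type.\<close>
  define ok where "ok f a Q \<longleftrightarrow> (a \<in> carrier G \<longrightarrow> Q \<in> Linf \<and> subpattern P Q \<and>
     dom Q = dom P \<union> under r a \<and> (\<forall>b\<in>underS r a. subpattern (f b) Q))"
    for f :: "'g \<Rightarrow> ('g \<rightharpoonup> 'a)" and a Q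
  have "\<exists>f. \<forall>a. ok f a (f a)"
  proof (rule dependent_wf_choice [OF wf])
    fix Q and f g :: "'g \<Rightarrow> ('g \<rightharpoonup> 'a)" and a
    assume "\<And>b. (b, a) \<in> r - Id \<Longrightarrow> f b = g b"
    then show "ok f a Q = ok g a Q" by (auto simp: ok_def underS_def)
  next
    fix a and f :: "'g \<Rightarrow> ('g \<rightharpoonup> 'a)"
    assume IH: "\<And>b. (b, a) \<in> r - Id \<Longrightarrow> ok f b (f b)"
    show "\<exists>Q. ok f a Q"
    proof (cases "a \<in> carrier G")
      case a: True
      let ?I = "underS r a"
      have I: "?I \<subseteq> carrier G" using rC by (auto simp: underS_def)
      have f: "f b \<in> Linf" "subpattern P (f b)" "dom (f b) = dom P \<union> under r b"
        "\<And>c. c \<in> underS r b \<Longrightarrow> subpattern (f c) (f b)" if "b \<in> ?I" for b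
      proof -
        have "b \<in> carrier G" "(b, a) \<in> r - Id" using that I by (auto simp: underS_def)
        then show "f b \<in> Linf" "subpattern P (f b)" "dom (f b) = dom P \<union> under r b"
          "\<And>c. c \<in> underS r b \<Longrightarrow> subpattern (f c) (f b)"
          using IH [of b] unfolding ok_def by blast+
      qed
      \<comment> \<open>\<open>U\<close> collects all stages strictly before \<open>a\<close>. At
        the least element there are none, and chains are nonempty, so there \<open>P\<close> itself
        is taken.\<close>
      have "\<exists>U\<in>Linf. subpattern P U \<and> dom U = dom P \<union> ?I \<and> (\<forall>b\<in>?I. subpattern (f b) U)"
      proof (cases "?I = {}")
        case True
        then show ?thesis using P(1) by (intro bexI [of _ P]) auto
      next
        case False
        let ?U = "chain_union ?I f"
        have un: "(\<Union>b\<in>?I. dom (f b)) = dom P \<union> ?I"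
        proof
          show "(\<Union>b\<in>?I. dom (f b)) \<subseteq> dom P \<union> ?I"
          proof (intro UN_least)
            fix b assume b: "b \<in> ?I"
            \<comment> \<open>Transitivity puts \<open>c\<close> below \<open>a\<close>;
              \<open>c = a\<close> would force \<open>b = a\<close> by antisymmetry.\<close>
            have "under r b \<subseteq> ?I"
            proof
              fix c assume "c \<in> under r b"
              then have "(c, b) \<in> r" "(b, a) \<in> r" "b \<noteq> a"
                using b by (auto simp: under_def underS_def)
              then show "c \<in> ?I"
                using transD [OF tr] antisymD [OF anti] by (auto simp: underS_def)
            qed
            then show "dom (f b) \<subseteq> dom P \<union> ?I" using f(3) [OF b] by auto
          qed
          have "b \<in> under r b" if "b \<in> ?I" for b
            using that I refl by (auto simp: under_def refl_on_def)
          then have "?I \<subseteq> (\<Union>b\<in>?I. dom (f b))" using f(3) by auto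
          moreover have "dom P \<subseteq> (\<Union>b\<in>?I. dom (f b))" using f(3) False by auto
          ultimately show "dom P \<union> ?I \<subseteq> (\<Union>b\<in>?I. dom (f b))" by simp
        qed
        have wI: "well_order_on ?I (Restr r ?I)"
          using well_order_on_Well_order [OF wo] I by (intro well_order_on_Restr) auto
        have chain: "increasing_chain Linf ?I (Restr r ?I) f"
          unfolding increasing_chain_def
        proof (intro conjI ballI impI)
          show "f ` ?I \<subseteq> Linf" using f(1) by blast
          fix b c assume "b \<in> ?I" "c \<in> ?I" "(b, c) \<in> Restr r ?I \<and> b \<noteq> c"
          then show "subpattern (f b) (f c)" using f(4) [of c b] by (simp add: underS_def)
        qed (use False wI in auto)
        \<comment> \<open>Removing the finite set \<open>dom P\<close> from the infinite tail leaves
          an infinite set.\<close>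
        have "infinite (carrier G - ?I - dom P)" using tail [OF a] P(2) by simp
        then have "proper_chain G ?I f"
          by (simp add: proper_chain_def un Diff_eq Int_ac)
        \<comment> \<open>The chain is indexed by group elements rather than by partial maps, hence
          the version for arbitrary index types.\<close>
        then have "?U \<in> Linf" using chain_closed_any_index [OF L4 chain] by blast
        moreover have *: "subpattern (f b) ?U" if "b \<in> ?I" for b
          using chain_union_apply [OF chain that] by (simp add: map_le_def)
        moreover have "subpattern P ?U"
        proof -
          obtain b where "b \<in> ?I" using False by blast
          then show ?thesis using map_le_trans [OF f(2) *] by simp
        qed
        moreover have "dom ?U = dom P \<union> ?I" by (simp add: dom_chain_union un)
        ultimately show ?thesis by (intro bexI [of _ ?U]) auto
      qed
      then obtain U where U: "U \<in> Linf" "subpattern P U" "dom U = dom P \<union> ?I"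
        "\<And>b. b \<in> ?I \<Longrightarrow> subpattern (f b) U" by blast
      obtain Q where Q: "Q \<in> Linf" "subpattern U Q" "dom Q = dom U \<union> {a}"
        using L2 U(1) a by blast
      \<comment> \<open>Adjoining \<open>a\<close> turns the open segment into the closed one;
        nothing breaks if \<open>a\<close> already lies in \<open>dom P\<close>.\<close>
      have "under r a = ?I \<union> {a}" using a refl by (auto simp: under_def underS_def refl_on_def)
      then have "ok f a Q"
        using Q U map_le_trans [OF _ Q(2)] by (simp add: ok_def Un_assoc)
      then show ?thesis by blast
    qed (simp add: ok_def)
  qed
  then obtain f where ok: "\<And>a. ok f a (f a)" by blast
  have f: "f a \<in> Linf" "subpattern P (f a)" "dom (f a) = dom P \<union> under r a"
    "\<And>b. b \<in> underS r a \<Longrightarrow> subpattern (f b) (f a)" if "a \<in> carrier G" for a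
    using ok [of a] that by (auto simp: ok_def)
  have self: "a \<in> dom (f a)" if "a \<in> carrier G" for a
    using f(3) [OF that] that refl by (auto simp: under_def refl_on_def)
  \<comment> \<open>The limit is read off diagonally: the value at \<open>a\<close> is the one
    present at stage \<open>a\<close>.\<close>
  define x where "x = (\<lambda>a\<in>carrier G. the (f a a))"
  have fx: "f a a = Some (x a)" if "a \<in> carrier G" for a
    using self [OF that] that by (auto simp: x_def)
  have "x \<in> carrier G \<rightarrow>\<^sub>E A"
  proof (rule PiE_I)
    fix a assume a: "a \<in> carrier G"
    have "ran (f a) \<subseteq> A" using f(1) [OF a] ext by (auto simp: extended_pattern_def)
    then show "x a \<in> A" using ranI [of "f a" a, OF fx [OF a]] by blast
  qed (simp add: x_def)
  moreover have "P l = Some (x l)" if "l \<in> dom P" for l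
  proof -
    have l: "l \<in> carrier G" using that domP by blast
    show ?thesis using f(2) [OF l] that fx [OF l] by (simp add: map_le_def)
  qed
  moreover have "(Some \<circ> x) |` F \<in> Linf" if F: "finite F" "F \<subseteq> carrier G" for F
  proof -
    \<comment> \<open>A finite window has an upper bound \<open>m\<close> in the total order, so
      stage \<open>m\<close> already covers all of it.\<close>
    have "\<exists>m\<in>carrier G. \<forall>b\<in>F. (b, m) \<in> r"
      using F
    proof (induction F rule: finite_induct)
      case empty
      then show ?case using inf by (metis empty_iff equals0I finite.emptyI)
    next
      case (insert c F)
      then obtain m where m: "m \<in> carrier G" "\<forall>b\<in>F. (b, m) \<in> r" by auto
      have "c \<in> carrier G" using insert.prems by simp
      then have "(c, m) \<in> r \<or> (m, c) \<in> r \<and> (c, c) \<in> r"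
        using m(1) tot refl by (cases "c = m") (auto simp: total_on_def refl_on_def)
      then show ?case
      proof
        assume "(c, m) \<in> r"
        then show ?thesis using m by auto
      next
        assume "(m, c) \<in> r \<and> (c, c) \<in> r"
        then show ?thesis
          using m(2) transD [OF tr] \<open>c \<in> carrier G\<close> by (intro bexI [of _ c]) auto
      qed
    qed
    then obtain m where m: "m \<in> carrier G" "\<forall>b\<in>F. (b, m) \<in> r" by blast
    \<comment> \<open>Stage \<open>m\<close> extends stage \<open>b\<close>, so the diagonal value
      at \<open>b\<close> persists there.\<close>
    have "Some (x b) = f m b" if "b \<in> F" for b
    proof (cases "b = m")
      case False
      have b: "b \<in> carrier G" using that F by blast
      have "subpattern (f b) (f m)" using False m that f(4) by (simp add: underS_def)
      then show ?thesis using self [OF b] fx [OF b] by (simp add: map_le_def)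
    qed (use fx m in simp)
    then have "subpattern ((Some \<circ> x) |` F) (f m)"
      by (auto simp: map_le_def)
    then show ?thesis using L1 f(1) m(1) by blast
  qed
  ultimately show ?thesis by blast
qed

text \<open>\<open>Some \<circ> x\<close> turns a configuration into a partial map, comparable with
  members of \<open>L\<close> once restricted. Only finite windows are tested: a full configuration
  has empty complement, so it is never an extended pattern.\<close>

definition language_configurations ::
  "('g, 'm) monoid_scheme \<Rightarrow> 'a set \<Rightarrow> ('g \<rightharpoonup> 'a) set \<Rightarrow> ('g \<Rightarrow> 'a) set" where
  "language_configurations G A L =
     {x \<in> carrier G \<rightarrow>\<^sub>E A. \<forall>F. finite F \<and> F \<subseteq> carrier G \<longrightarrow> (Some \<circ> x) |` F \<in> L}"

lemma closedin_language_configurations: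
  "closedin (prodiscrete G A) (language_configurations G A L)"
proof -
  let ?X = "language_configurations G A L"
  have top: "topspace (prodiscrete G A) = carrier G \<rightarrow>\<^sub>E A"
    by (simp add: prodiscrete_def)
  have "openin (prodiscrete G A) ((carrier G \<rightarrow>\<^sub>E A) - ?X)"
  proof (subst openin_subopen, intro ballI)
    fix x assume x: "x \<in> (carrier G \<rightarrow>\<^sub>E A) - ?X"
    then obtain F where F: "finite F" "F \<subseteq> carrier G" "(Some \<circ> x) |` F \<notin> L"
      by (auto simp: language_configurations_def)
    \<comment> \<open>The cylinder of configurations agreeing with \<open>x\<close> on the failing
      window \<open>F\<close>: it is a basic open set, and all its points fail on \<open>F\<close>
      too.\<close>
    let ?U = "Pi\<^sub>E (carrier G) (\<lambda>i. if i \<in> F then {x i} else A)"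
    have "{i. (if i \<in> F then {x i} else A) \<noteq> topspace (discrete_topology A)} \<subseteq> F" by auto
    then have "openin (prodiscrete G A) ?U"
      unfolding prodiscrete_def using F x
      by (intro product_topology_basis) (auto intro: finite_subset)
    moreover have "x \<in> ?U" using x by (auto simp: PiE_iff)
    moreover have "?U \<subseteq> (carrier G \<rightarrow>\<^sub>E A) - ?X"
    proof
      fix y assume y: "y \<in> ?U"
      then have yx: "y i = x i" if "i \<in> F" for i using that F by (fastforce dest: PiE_mem)
      have "y \<in> carrier G \<rightarrow>\<^sub>E A"
      proof (rule PiE_I)
        fix i assume i: "i \<in> carrier G"
        then have "x i \<in> A" using x by (auto simp: PiE_iff)
        then show "y i \<in> A" using PiE_mem [OF y i] by (auto split: if_splits)
      qed (use y in \<open>rule PiE_arb\<close>)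
      moreover have "(Some \<circ> y) |` F = (Some \<circ> x) |` F"
        using yx by (auto simp: restrict_map_def)
      ultimately show "y \<in> (carrier G \<rightarrow>\<^sub>E A) - ?X"
        using F by (auto simp: language_configurations_def)
    qed
    ultimately show "\<exists>T. openin (prodiscrete G A) T \<and> x \<in> T \<and> T \<subseteq> (carrier G \<rightarrow>\<^sub>E A) - ?X"
      by blast
  qed
  then show ?thesis by (auto simp: closedin_def top language_configurations_def)
qed

text \<open>The window of the shifted configuration on \<open>F\<close> is the window of
  \<open>x\<close> on the translate of \<open>F\<close> by \<open>g\<close>, moved back by the
  inverse of \<open>g\<close>. Hence the invariance required is under that inverse.\<close>

lemma shift_in_language_configurations:
  assumes "group G" and "g \<in> carrier G"
    and inv: "\<forall>P\<in>L. shifted_pattern G (inv\<^bsub>G\<^esub> g) P \<in> L"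
    and x: "x \<in> language_configurations G A L"
  shows "shift G g x \<in> language_configurations G A L"
proof -
  interpret group G by fact
  have xA: "x \<in> carrier G \<rightarrow>\<^sub>E A" using x by (simp add: language_configurations_def)
  have "shift G g x \<in> carrier G \<rightarrow>\<^sub>E A"
    using xA assms(2) by (auto simp: shift_def PiE_iff)
  moreover have "(Some \<circ> shift G g x) |` F \<in> L" if F: "finite F" "F \<subseteq> carrier G" for F
  proof -
    let ?P = "(Some \<circ> x) |` ((\<lambda>l. g \<otimes>\<^bsub>G\<^esub> l) ` F)"
    have dom: "dom ?P = (\<lambda>l. g \<otimes>\<^bsub>G\<^esub> l) ` F" by auto
    have cancel: "inv\<^bsub>G\<^esub> g \<otimes>\<^bsub>G\<^esub> (g \<otimes>\<^bsub>G\<^esub> l) = l" if "l \<in> F" for l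
      using that F assms(2) by (auto simp: m_assoc [symmetric])
    have "(\<lambda>l. inv\<^bsub>G\<^esub> g \<otimes>\<^bsub>G\<^esub> l) ` dom ?P = F"
      unfolding dom image_image using cancel by force
    then have "(Some \<circ> shift G g x) |` F = shifted_pattern G (inv\<^bsub>G\<^esub> g) ?P"
      using F assms(2) by (auto simp: fun_eq_iff shifted_pattern_def restrict_map_def shift_def)
    moreover have "?P \<in> L"
    proof -
      have "finite ((\<lambda>l. g \<otimes>\<^bsub>G\<^esub> l) ` F)" "(\<lambda>l. g \<otimes>\<^bsub>G\<^esub> l) ` F \<subseteq> carrier G"
        using F assms(2) by auto
      then show ?thesis using x unfolding language_configurations_def by blast
    qed
    ultimately show ?thesis using inv by metis
  qed
  ultimately show ?thesis by (simp add: language_configurations_def)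
qed

theorem theorem2p1:
  fixes G :: "('g, 'm) monoid_scheme" and H :: "'g set" and A :: "'a set"
    and Linf :: "('g \<rightharpoonup> 'a) set"
  assumes "group G" and "uncountable (carrier G)" and "subgroup H G" and "alphabet A"
    and "Linf \<noteq> {}" and "\<forall>P\<in>Linf. extended_pattern G A P"
    and L1: "\<forall>P\<in>Linf. \<forall>Q. subpattern Q P \<longrightarrow> Q \<in> Linf"
    and L2: "\<forall>Q\<in>Linf. \<forall>g\<in>carrier G. \<exists>P\<in>Linf. subpattern Q P \<and> dom P = dom Q \<union> {g}"
    and L3: "\<forall>P\<in>Linf. \<forall>g\<in>H. shifted_pattern G g P \<in> Linf"
    and L4: "chain_closed G Linf"
  shows "\<exists>X. subshift G H A X \<and> language G A X = {P \<in> Linf. pattern G A P}"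
proof (intro exI conjI)
  interpret group G by fact
  let ?X = "language_configurations G A Linf"
  have inf: "infinite (carrier G)" using assms(2) countable_finite by blast
  have extend: "\<exists>x\<in>?X. \<forall>l\<in>dom P. P l = Some (x l)" if "P \<in> Linf" "finite (dom P)" for P
    using extend_to_configuration [OF inf assms(6) L1 L2 L4 that]
    by (auto simp: language_configurations_def)
  show "subshift G H A ?X"
    unfolding subshift_def
  proof (intro conjI ballI)
    \<comment> \<open>The empty map is a subpattern of any member of \<open>Linf\<close>.\<close>
    have "Map.empty \<in> Linf" using assms(5) L1 by fastforce
    then show "?X \<noteq> {}" using extend [of Map.empty] by auto
    show "closedin (prodiscrete G A) ?X" by (rule closedin_language_configurations)
    have maps: "shift G g x \<in> ?X" if "g \<in> H" "x \<in> ?X" for g x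
      using shift_in_language_configurations [OF assms(1) _ _ that(2)] that(1) L3
        subgroup.m_inv_closed [OF assms(3)] subgroup.mem_carrier [OF assms(3)] by blast
    fix g assume g: "g \<in> H"
    then have gc: "g \<in> carrier G" using subgroup.mem_carrier [OF assms(3)] by blast
    have "x \<in> shift G g ` ?X" if x: "x \<in> ?X" for x
    proof
      show "shift G (inv\<^bsub>G\<^esub> g) x \<in> ?X"
        using maps x g subgroup.m_inv_closed [OF assms(3)] by blast
      \<comment> \<open>Shifting back and forth restores \<open>x\<close> on the carrier;
        extensionality gives equality outside it.\<close>
      have "x \<in> extensional (carrier G)"
        using x by (auto simp: language_configurations_def PiE_def)
      then show "x = shift G g (shift G (inv\<^bsub>G\<^esub> g) x)"
        using gc by (auto simp: shift_def fun_eq_iff m_assoc [symmetric] extensional_def)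
    qed
    then show "shift G g ` ?X = ?X" using maps g by blast
  qed
  show "language G A ?X = {P \<in> Linf. pattern G A P}"
  proof (intro equalityI subsetI)
    fix P assume P: "P \<in> language G A ?X"
    then obtain x where x: "x \<in> ?X" "\<forall>l\<in>dom P. P l = Some (x l)"
      by (auto simp: language_def allowed_def)
    \<comment> \<open>An allowed pattern is itself a finite window of \<open>x\<close>, so it lies
      in \<open>Linf\<close> by the choice of the subshift.\<close>
    have "P = (Some \<circ> x) |` dom P"
    proof
      fix l show "P l = ((Some \<circ> x) |` dom P) l"
        using x(2) by (cases "l \<in> dom P") (auto simp: restrict_map_def)
    qed
    moreover have "(Some \<circ> x) |` dom P \<in> Linf"
      using x(1) P by (auto simp: language_configurations_def language_def pattern_def)
    ultimately show "P \<in> {P \<in> Linf. pattern G A P}"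
      using P by (simp add: language_def)
  next
    fix P assume "P \<in> {P \<in> Linf. pattern G A P}"
    then show "P \<in> language G A ?X"
      using extend by (auto simp: language_def allowed_def pattern_def)
  qed
qed

end
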